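(* For every integer $n\geq 3$, writing $f_q(n)$ for the total number of occurrences of the pattern $q$ in all permutations of $S_n(132,231)$, we have $$f_{123}(n)=f_{213}(n)=f_{312}(n)=f_{321}(n)=\binom{n}{3}2^{n-3}.$$
   Context: $S_n$ is the set of permutations of $\{1,\dots,n\}$ written in one-line notation $\sigma=\sigma_1\sigma_2\cdots\sigma_n$. For $q\in S_k$, an occurrence of the pattern $q$ in $\sigma\in S_n$ is a choice of indices $i_1<i_2<\cdots<i_k$ in $\{1,\dots,n\}$ such that for all $1\le j,l\le k$, $q_j<q_l$ if and only if $\sigma_{i_j}<\sigma_{i_l}$. Let $f_q(\sigma)$ be the number of occurrences of $q$ in $\sigma$; $\sigma$ avoids $q$ if $f_q(\sigma)=0$. $S_n(132,231)$ is the set of permutations in $S_n$ avoiding both $132$ and $231$, and $f_q(n)=\sum_{\sigma\in S_n(132,231)}f_q(\sigma)$. *)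

theory Defs
  imports "HOL-Combinatorics.Multiset_Permutations"
begin

text \<open>
  A permutation in \<open>S\<^sub>n\<close> is represented by its one-line notation, a list in
  \<^term>\<open>permutations_of_set {1..n::nat}\<close>.  Positions in a list are numbered from \<open>0\<close>, so that
  \<open>\<sigma>\<^sub>i\<close> is \<open>\<sigma> ! (i - 1)\<close>; in particular the indices of an occurrence below are
  shifted by one.
\<close>

definition perms :: "nat \<Rightarrow> nat list set" where
  "perms n = permutations_of_set {1..n}"

text \<open>An occurrence \<open>i\<^sub>1 < \<dots> < i\<^sub>k\<close> is the strictly increasing list of its indices.\<close>

definition occurrences :: "nat list \<Rightarrow> nat list \<Rightarrow> nat list set" where
  "occurrences q \<sigma> =
     {is. length is = length q \<and> sorted_wrt (<) is \<and> set is \<subseteq> {..<length \<sigma>} \<and>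
          (\<forall>j<length q. \<forall>l<length q. q ! j < q ! l \<longleftrightarrow> \<sigma> ! (is ! j) < \<sigma> ! (is ! l))}"

definition occ_count :: "nat list \<Rightarrow> nat list \<Rightarrow> nat" where
  "occ_count q \<sigma> = card (occurrences q \<sigma>)"

definition avoids :: "nat list \<Rightarrow> nat list \<Rightarrow> bool" where
  "avoids \<sigma> q \<longleftrightarrow> occ_count q \<sigma> = 0"

definition perms_avoiding_132_231 :: "nat \<Rightarrow> nat list set" where
  "perms_avoiding_132_231 n = {\<sigma> \<in> perms n. avoids \<sigma> [1,3,2] \<and> avoids \<sigma> [2,3,1]}"

definition total_occ :: "nat list \<Rightarrow> nat \<Rightarrow> nat" where
  "total_occ q n = (\<Sum>\<sigma>\<in>perms_avoiding_132_231 n. occ_count q \<sigma>)"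

text \<open>
  Both \<^const>\<open>card\<close> and \<^const>\<open>sum\<close> are \<open>0\<close> on infinite sets, so the definitions above are
  meaningful because of the following facts.
\<close>

lemma finite_occurrences: "finite (occurrences q \<sigma>)"
proof (rule finite_subset)
  show "occurrences q \<sigma> \<subseteq> {is. set is \<subseteq> {..<length \<sigma>} \<and> length is = length q}"
    by (auto simp: occurrences_def)
qed (simp add: finite_lists_length_eq)

lemma finite_perms_avoiding_132_231: "finite (perms_avoiding_132_231 n)"
  by (simp add: perms_avoiding_132_231_def perms_def)

end

theory Submission imports Defs begin

text \<open>
  In a permutation of \<open>{1..n + 1}\<close> avoiding 132 and 231 the maximum stands at one of the two ends,
  since otherwise it is the 3 of a forbidden pattern formed with its two neighbours. So the
  avoiders of size \<open>n + 1\<close> arise from those of size \<open>n\<close> by attaching \<open>n + 1\<close> at either end, and if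
  \<open>q\<close> ends in its maximum, with \<open>p\<close> the pattern obtained by deleting it, then
  \<open>f\<^sub>q(n + 1) = 2 f\<^sub>q(n) + f\<^sub>p(n)\<close>. This recurrence is Pascal's rule for
  \<open>f\<^sub>q(n) = (n choose k) 2 ^ (n - k)\<close>, \<open>k\<close> being the length of \<open>q\<close>. It settles 123 and 213, and the
  other two patterns are their reversals.
\<close>

section \<open>Occurrences under reversal\<close>

lemma occurrences_rev_subset:
  "(\<lambda>is. rev (map (\<lambda>i. length \<sigma> - Suc i) is)) ` occurrences q \<sigma> \<subseteq> occurrences (rev q) (rev \<sigma>)"
proof (rule image_subsetI)
  fix "is" assume "is \<in> occurrences q \<sigma>"
  then have len: "length is = length q" and srt: "sorted_wrt (<) is"
    and sub: "set is \<subseteq> {..<length \<sigma>}"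
    and pat: "\<And>j l. j < length q \<Longrightarrow> l < length q \<Longrightarrow> q ! j < q ! l \<longleftrightarrow> \<sigma> ! (is ! j) < \<sigma> ! (is ! l)"
    by (auto simp: occurrences_def)
  let ?js = "rev (map (\<lambda>i. length \<sigma> - Suc i) is)"
  have bnd: "is ! j < length \<sigma>" if "j < length q" for j
    by (metis that sub len lessThan_iff nth_mem subsetD)
  have "sorted_wrt (\<lambda>x y. length \<sigma> - Suc y < length \<sigma> - Suc x) is"
  proof (rule sorted_wrt_mono_rel[OF _ srt])
    fix x y assume "x < y" "y \<in> set is"
    with sub have "y < length \<sigma>" by blast
    with \<open>x < y\<close> show "length \<sigma> - Suc y < length \<sigma> - Suc x" by linarith
  qed
  then have "sorted_wrt (<) ?js"
    by (simp add: sorted_wrt_rev sorted_wrt_map)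
  moreover have "set ?js \<subseteq> {..<length (rev \<sigma>)}"
    using sub by auto
  moreover have "rev \<sigma> ! (?js ! j) = \<sigma> ! (is ! (length q - Suc j))" if "j < length q" for j
  proof -
    have "is ! (length q - Suc j) < length \<sigma>"
      using that by (intro bnd) simp
    then show ?thesis
      using that len by (simp add: rev_nth Suc_diff_Suc)
  qed
  ultimately show "?js \<in> occurrences (rev q) (rev \<sigma>)"
    by (auto simp: occurrences_def len rev_nth pat)
qed

text \<open>Reflecting positions injects occurrences one way; the same bound for
  \<open>rev q\<close> and \<open>rev \<sigma>\<close> gives the converse, as \<open>rev\<close> is
  an involution.\<close>

lemma occ_count_rev: "occ_count (rev q) (rev \<sigma>) = occ_count q \<sigma>"
proof -
  have le: "occ_count q \<sigma> \<le> occ_count (rev q) (rev \<sigma>)" for q \<sigma>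
    unfolding occ_count_def
  proof (rule card_inj_on_le[OF _ occurrences_rev_subset finite_occurrences])
    show "inj_on (\<lambda>is. rev (map (\<lambda>i. length \<sigma> - Suc i) is)) (occurrences q \<sigma>)"
    proof (rule inj_onI)
      fix xs ys
      assume "xs \<in> occurrences q \<sigma>" "ys \<in> occurrences q \<sigma>"
        and eq: "rev (map (\<lambda>i. length \<sigma> - Suc i) xs) = rev (map (\<lambda>i. length \<sigma> - Suc i) ys)"
      then have "set xs \<union> set ys \<subseteq> {..<length \<sigma>}"
        by (auto simp: occurrences_def)
      \<comment> \<open>Truncated subtraction is injective only on genuine positions.\<close>
      moreover have "inj_on (\<lambda>i. length \<sigma> - Suc i) {..<length \<sigma>}"
        by (auto simp: inj_on_def)
      ultimately have "inj_on (\<lambda>i. length \<sigma> - Suc i) (set xs \<union> set ys)"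
        by (rule inj_on_subset[rotated])
      with eq show "xs = ys"
        by (simp add: inj_on_map_eq_map)
    qed
  qed
  show ?thesis
    using le[of q \<sigma>] le[of "rev q" "rev \<sigma>"] by simp
qed

section \<open>Counting occurrences after attaching a maximum\<close>

lemma occ_count_Nil: "occ_count [] \<sigma> = 1"
proof -
  have "occurrences [] \<sigma> = {[]}"
    by (auto simp: occurrences_def)
  then show ?thesis
    by (simp add: occ_count_def)
qed

lemma occ_count_longer:
  assumes "length \<sigma> < length q"
  shows "occ_count q \<sigma> = 0"
proof -
  have "length is \<le> length \<sigma>" if "is \<in> occurrences q \<sigma>" for "is"
  proof -
    have "distinct is" "set is \<subseteq> {..<length \<sigma>}"
      using that by (auto simp: occurrences_def strict_sorted_iff)
    then show ?thesis
      by (metis card_lessThan card_mono distinct_card finite_lessThan)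
  qed
  then have "occurrences q \<sigma> = {}"
    using assms by (fastforce simp: occurrences_def)
  then show ?thesis
    by (simp add: occ_count_def)
qed

lemma occurrences_snoc_old:
  "{is \<in> occurrences q (\<tau> @ [m]). length \<tau> \<notin> set is} = occurrences q \<tau>"
proof -
  have "is \<in> occurrences q (\<tau> @ [m]) \<and> length \<tau> \<notin> set is \<longleftrightarrow> is \<in> occurrences q \<tau>" for "is"
  proof (cases "length is = length q \<and> set is \<subseteq> {..<length \<tau>}")
    case True
    then have "is ! j < length \<tau>" if "j < length q" for j
      by (metis that lessThan_iff nth_mem subsetD)
    with True show ?thesis
      by (auto simp: occurrences_def nth_append less_Suc_eq)
  next
    case False
    then show ?thesis
      by (auto simp: occurrences_def less_Suc_eq subset_iff)
  qed
  then show ?thesis by blast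
qed

text \<open>As \<open>m\<close> exceeds every entry of \<open>\<tau>\<close>, it can only play the
  role of a strict maximum of the pattern; all comparisons with it then hold automatically.\<close>

lemma snoc_mem_occurrences:
  assumes "\<forall>x\<in>set \<tau>. x < m"
  shows "is @ [length \<tau>] \<in> occurrences (p @ [k]) (\<tau> @ [m]) \<longleftrightarrow>
    (\<forall>x\<in>set p. x < k) \<and> is \<in> occurrences p \<tau>"
proof (cases "length is = length p \<and> set is \<subseteq> {..<length \<tau>}")
  case True
  then have bnd: "is ! j < length \<tau>" if "j < length p" for j
    by (metis that lessThan_iff nth_mem subsetD)
  have val: "\<tau> ! (is ! j) < m" if "j < length p" for j
    using bnd[OF that] assms by simp
  have "(\<forall>j<Suc (length p). \<forall>l<Suc (length p). (p @ [k]) ! j < (p @ [k]) ! l \<longleftrightarrow>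
      (\<tau> @ [m]) ! ((is @ [length \<tau>]) ! j) < (\<tau> @ [m]) ! ((is @ [length \<tau>]) ! l)) \<longleftrightarrow>
    (\<forall>j<length p. p ! j < k) \<and>
    (\<forall>j<length p. \<forall>l<length p. p ! j < p ! l \<longleftrightarrow> \<tau> ! (is ! j) < \<tau> ! (is ! l))"
    using True bnd val
    by (auto simp: nth_append less_Suc_eq all_conj_distrib dest: less_asym less_imp_not_less)
  then show ?thesis
    using True bnd by (auto simp: occurrences_def sorted_wrt_append all_set_conv_all_nth less_SucI)
next
  case False
  then show ?thesis
    by (auto simp: occurrences_def sorted_wrt_append subset_iff)
qed

text \<open>Occurrences are split by whether they use the new position
  \<open>length \<tau>\<close>.\<close>

lemma occ_count_snoc:
  assumes "\<forall>x\<in>set \<tau>. x < m"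
  shows "occ_count (p @ [k]) (\<tau> @ [m]) =
    occ_count (p @ [k]) \<tau> + (if \<forall>x\<in>set p. x < k then occ_count p \<tau> else 0)"
proof -
  let ?O = "occurrences (p @ [k]) (\<tau> @ [m])"
  let ?N = "{is \<in> ?O. length \<tau> \<in> set is}"
  \<comment> \<open>The new position is the largest, so it ends any increasing list containing
    it.\<close>
  have last: "\<exists>js. is = js @ [length \<tau>]" if "is \<in> ?N" for "is"
  proof -
    from that have "is \<noteq> []" and srt: "sorted_wrt (<) is" and sub: "set is \<subseteq> {..<Suc (length \<tau>)}"
      and mem: "length \<tau> \<in> set is"
      by (auto simp: occurrences_def)
    then obtain js i where js: "is = js @ [i]"
      by (metis rev_exhaust)
    then show ?thesis
      using srt sub mem by (auto simp: sorted_wrt_append)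
  qed
  have "?N = (\<lambda>is. is @ [length \<tau>]) ` (if \<forall>x\<in>set p. x < k then occurrences p \<tau> else {})"
    using last snoc_mem_occurrences[OF assms, of _ p k] by (auto split: if_splits)
  then have "card ?N = (if \<forall>x\<in>set p. x < k then occ_count p \<tau> else 0)"
    by (simp add: card_image inj_on_def occ_count_def)
  moreover have "card ?O = card {is \<in> ?O. length \<tau> \<notin> set is} + card ?N"
    by (subst card_Un_disjoint[symmetric])
      (auto simp: finite_occurrences intro: arg_cong[where f = card])
  ultimately show ?thesis
    by (simp add: occ_count_def occurrences_snoc_old)
qed

lemma occ_count_Cons:
  assumes "\<forall>x\<in>set \<tau>. x < m"
  shows "occ_count (k # p) (m # \<tau>) =
    occ_count (k # p) \<tau> + (if \<forall>x\<in>set p. x < k then occ_count p \<tau> else 0)"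
  using occ_count_snoc[of "rev \<tau>" m "rev p" k] assms
  by (simp add: occ_count_rev flip: rev.simps(2))

section \<open>Structure of the avoiding permutations\<close>

lemma mem_perms_avoiding_iff:
  "\<sigma> \<in> perms_avoiding_132_231 n \<longleftrightarrow>
    set \<sigma> = {1..n} \<and> distinct \<sigma> \<and> occ_count [1,3,2] \<sigma> = 0 \<and> occ_count [2,3,1] \<sigma> = 0"
  by (auto simp: perms_avoiding_132_231_def perms_def avoids_def permutations_of_set_def)

text \<open>The two forbidden patterns are reversals of each other.\<close>

lemma rev_mem_perms_avoiding:
  "rev \<sigma> \<in> perms_avoiding_132_231 n \<longleftrightarrow> \<sigma> \<in> perms_avoiding_132_231 n"
  using occ_count_rev[of "[1,3,2]" \<sigma>] occ_count_rev[of "[2,3,1]" \<sigma>]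
  by (auto simp: mem_perms_avoiding_iff)

text \<open>The three adjacent entries form 132 if \<open>a < b\<close> and 231 if
  \<open>b < a\<close>.\<close>

lemma occ_count_interior_max:
  assumes "a < m" "b < m" "a \<noteq> b"
  shows "occ_count [1,3,2] (xs @ a # m # b # ys) + occ_count [2,3,1] (xs @ a # m # b # ys) \<noteq> 0"
proof -
  let ?is = "[length xs, Suc (length xs), Suc (Suc (length xs))]"
  let ?\<sigma> = "xs @ a # m # b # ys"
  have "?is \<in> occurrences [1,3,2] ?\<sigma> \<or> ?is \<in> occurrences [2,3,1] ?\<sigma>"
    using assms by (auto simp: occurrences_def nth_append All_less_Suc)
  then show ?thesis
    by (auto simp: occ_count_def finite_occurrences)
qed

lemma perms_avoiding_Suc:
  "perms_avoiding_132_231 (Suc n) =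
    (\<lambda>\<tau>. Suc n # \<tau>) ` perms_avoiding_132_231 n \<union> (\<lambda>\<tau>. \<tau> @ [Suc n]) ` perms_avoiding_132_231 n"
    (is "?L = ?R")
proof
  \<comment> \<open>Neither forbidden pattern begins with its maximum, so
    \<open>occ_count_Cons\<close> leaves both counts unchanged.\<close>
  have cons: "Suc n # \<tau> \<in> ?L \<longleftrightarrow> \<tau> \<in> perms_avoiding_132_231 n" if "set \<tau> = {1..n}" for \<tau>
  proof -
    from that have "\<forall>x\<in>set \<tau>. x < Suc n" by auto
    from occ_count_Cons[OF this] that show ?thesis
      by (auto simp: mem_perms_avoiding_iff)
  qed
  have snoc: "\<tau> @ [Suc n] \<in> ?L \<longleftrightarrow> \<tau> \<in> perms_avoiding_132_231 n" if "set \<tau> = {1..n}" for \<tau>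
    using cons[of "rev \<tau>"] that rev_mem_perms_avoiding[of \<tau> n]
      rev_mem_perms_avoiding[of "\<tau> @ [Suc n]" "Suc n"] by simp
  show "?R \<subseteq> ?L"
  proof -
    have "Suc n # \<tau> \<in> ?L \<and> \<tau> @ [Suc n] \<in> ?L" if "\<tau> \<in> perms_avoiding_132_231 n" for \<tau>
    proof -
      from that have "set \<tau> = {1..n}"
        by (rule mem_perms_avoiding_iff[THEN iffD1, THEN conjunct1])
      then show ?thesis
        using that by (simp only: cons snoc)
    qed
    then show ?thesis by blast
  qed
  show "?L \<subseteq> ?R"
  proof
    fix \<sigma> assume \<sigma>: "\<sigma> \<in> ?L"
    then have st: "set \<sigma> = {1..Suc n}" and dist: "distinct \<sigma>"
      by (simp_all only: mem_perms_avoiding_iff)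
    from st have "Suc n \<in> set \<sigma>" by simp
    then obtain xs ys where split: "\<sigma> = xs @ Suc n # ys"
      using split_list by fast
    have rest: "set (xs @ ys) = {1..n}"
    proof -
      have "set (xs @ ys) = set \<sigma> - {Suc n}"
        using dist by (auto simp: split)
      also have "\<dots> = {1..n}"
        unfolding st by auto
      finally show ?thesis .
    qed
    have "xs = [] \<or> ys = []"
    proof (rule ccontr)
      assume "\<not> (xs = [] \<or> ys = [])"
      then obtain xs' a b ys' where eqs: "xs = xs' @ [a]" "ys = b # ys'"
        by (metis list.exhaust rev_exhaust)
      have "a \<in> {1..n}" "b \<in> {1..n}"
        unfolding rest[symmetric] eqs by simp_all
      moreover have "a \<noteq> b"
        using dist by (simp add: split eqs)
      ultimately show False
        using occ_count_interior_max[of a "Suc n" b xs' ys'] \<sigma>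
        by (simp add: mem_perms_avoiding_iff split eqs)
    qed
    then show "\<sigma> \<in> ?R"
    proof
      assume "xs = []"
      then have "ys \<in> perms_avoiding_132_231 n"
        using cons[of ys] rest \<sigma> unfolding split by simp
      then show ?thesis
        using \<open>xs = []\<close> unfolding split by simp
    next
      assume "ys = []"
      then have "xs \<in> perms_avoiding_132_231 n"
        using snoc[of xs] rest \<sigma> unfolding split by simp
      then show ?thesis
        using \<open>ys = []\<close> unfolding split by simp
    qed
  qed
qed

lemma perms_avoiding_0: "perms_avoiding_132_231 0 = {[]}"
  by (auto simp: mem_perms_avoiding_iff occ_count_longer)

lemma perms_avoiding_1: "perms_avoiding_132_231 (Suc 0) = {[Suc 0]}"
  by (simp add: perms_avoiding_Suc perms_avoiding_0)

text \<open>Fails for \<open>n = 0\<close>, where both ways of attaching the maximum give the same permutation.\<close>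

lemma sum_perms_avoiding_Suc:
  assumes "n \<ge> 1"
  shows "(\<Sum>\<sigma>\<in>perms_avoiding_132_231 (Suc n). g \<sigma>) =
    (\<Sum>\<tau>\<in>perms_avoiding_132_231 n. g (Suc n # \<tau>) + g (\<tau> @ [Suc n]))"
proof -
  let ?A = "perms_avoiding_132_231 n"
  have "Suc n # \<tau> \<noteq> \<tau>' @ [Suc n]" if "\<tau> \<in> ?A" "\<tau>' \<in> ?A" for \<tau> \<tau>'
  proof
    assume eq: "Suc n # \<tau> = \<tau>' @ [Suc n]"
    have st: "set \<tau>' = {1..n}"
      using that(2) by (simp add: mem_perms_avoiding_iff)
    with assms have "\<tau>' \<noteq> []" by auto
    with eq have "Suc n \<in> set \<tau>'" by (cases \<tau>') simp_all
    with st show False by simp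
  qed
  then have "(\<lambda>\<tau>. Suc n # \<tau>) ` ?A \<inter> (\<lambda>\<tau>. \<tau> @ [Suc n]) ` ?A = {}"
    by blast
  then show ?thesis
    by (simp add: perms_avoiding_Suc sum.union_disjoint finite_perms_avoiding_132_231
        sum.reindex inj_on_def sum.distrib)
qed

section \<open>Recurrence and closed form for the totals\<close>

lemma total_occ_rev: "total_occ (rev q) n = total_occ q n"
  unfolding total_occ_def
  by (rule sum.reindex_bij_witness[where i = rev and j = rev])
    (use occ_count_rev[of q] occ_count_rev[of "rev q"] in \<open>simp_all add: rev_mem_perms_avoiding\<close>)

text \<open>The empty pattern occurs once in each permutation, so this counts the avoiders, whose
  number doubles at each step from size 1 on.\<close>

lemma total_occ_Nil:
  assumes "n \<ge> 1"
  shows "total_occ [] n = 2 ^ (n - 1)"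
  using assms
proof (induction n rule: dec_induct)
  case base
  then show ?case
    by (simp add: total_occ_def perms_avoiding_1 occ_count_Nil)
next
  case (step n)
  then show ?case
    using sum_perms_avoiding_Suc[of n "occ_count []"] power_Suc[of "2::nat" "n - 1"]
    by (simp add: total_occ_def occ_count_Nil)
qed

text \<open>Every position is an occurrence. This case is treated directly because a maximum
  attached at either end adds an occurrence of \<open>[k]\<close>, unlike in
  \<open>total_occ_snoc_Suc\<close>.\<close>

lemma total_occ_singleton:
  assumes "n \<ge> 1"
  shows "total_occ [k] n = (n choose 1) * 2 ^ (n - 1)"
proof -
  have "occ_count [k] \<sigma> = n" if "\<sigma> \<in> perms_avoiding_132_231 n" for \<sigma>
  proof -
    have "occurrences [k] \<sigma> = (\<lambda>i. [i]) ` {..<length \<sigma>}"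
      by (auto simp: occurrences_def length_Suc_conv)
    then show ?thesis
      using that distinct_card[of \<sigma>]
      by (simp add: occ_count_def card_image inj_on_def mem_perms_avoiding_iff)
  qed
  then show ?thesis
    using total_occ_Nil[OF assms] by (simp add: total_occ_def occ_count_Nil)
qed

lemma total_occ_snoc_Suc:
  assumes "n \<ge> 1" "p \<noteq> []" "\<forall>x\<in>set p. x < k"
  shows "total_occ (p @ [k]) (Suc n) = 2 * total_occ (p @ [k]) n + total_occ p n"
proof -
  obtain a p' where p: "p = a # p'"
    using assms(2) by (cases p) auto
  have "occ_count (p @ [k]) (Suc n # \<tau>) + occ_count (p @ [k]) (\<tau> @ [Suc n]) =
      2 * occ_count (p @ [k]) \<tau> + occ_count p \<tau>"
    if "\<tau> \<in> perms_avoiding_132_231 n" for \<tau>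
  proof -
    have less: "\<forall>x\<in>set \<tau>. x < Suc n"
      using that by (auto simp: mem_perms_avoiding_iff)
    \<comment> \<open>The first entry \<open>a\<close> of the pattern is below \<open>k\<close>, so
      a maximum in front joins no occurrence.\<close>
    have "occ_count (p @ [k]) (Suc n # \<tau>) = occ_count (p @ [k]) \<tau>"
      using occ_count_Cons[OF less, of a "p' @ [k]"] assms(3) by (auto simp: p)
    then show ?thesis
      using occ_count_snoc[OF less, of p k] assms(3) by simp
  qed
  then show ?thesis
    by (simp add: total_occ_def sum_perms_avoiding_Suc[OF assms(1)] sum.distrib sum_distrib_left)
qed

lemma total_occ_snoc:
  assumes p: "\<And>n. n \<ge> 1 \<Longrightarrow> total_occ p n = (n choose length p) * 2 ^ (n - length p)"
    and k: "p \<noteq> []" "\<forall>x\<in>set p. x < k"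
    and n: "n \<ge> 1"
  shows "total_occ (p @ [k]) n = (n choose length (p @ [k])) * 2 ^ (n - length (p @ [k]))"
  using n
proof (induction n rule: dec_induct)
  case base
  show ?case
    \<comment> \<open>The pattern has at least two entries, so both sides vanish at size 1.\<close>
    using k(1) by (simp add: total_occ_def perms_avoiding_1 occ_count_longer)
next
  case (step n)
  \<comment> \<open>The factor 2 raises the exponent only if \<open>length p < n\<close>; otherwise
    truncated subtraction breaks this, but the binomial coefficient is 0.\<close>
  have "2 * ((n choose Suc (length p)) * 2 ^ (n - Suc (length p))) =
      (n choose Suc (length p)) * 2 ^ (n - length p)"
  proof (cases "length p < n")
    case True
    then have "n - length p = Suc (n - Suc (length p))" by simp
    then show ?thesis by simp
  qed (simp add: binomial_eq_0)
  with step show ?case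
    by (simp add: total_occ_snoc_Suc k p algebra_simps)
qed

theorem theorem2p11:
  fixes n :: nat
  assumes "n \<ge> 3"
  shows "total_occ [1,2,3] n = (n choose 3) * 2 ^ (n - 3)
       \<and> total_occ [2,1,3] n = (n choose 3) * 2 ^ (n - 3)
       \<and> total_occ [3,1,2] n = (n choose 3) * 2 ^ (n - 3)
       \<and> total_occ [3,2,1] n = (n choose 3) * 2 ^ (n - 3)"
proof -
  have t12: "total_occ [1,2] n = (n choose 2) * 2 ^ (n - 2)" if "n \<ge> 1" for n
    using total_occ_snoc[of "[1]" 2 n] total_occ_singleton that by (simp add: numeral_2_eq_2)
  \<comment> \<open>21 does not end in its maximum, so its formula comes from 12 by reversal; it is
    the prefix needed for 213.\<close>
  have t21: "total_occ [2,1] n = (n choose 2) * 2 ^ (n - 2)" if "n \<ge> 1" for n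
    using total_occ_rev[of "[1,2]" n] t12[OF that] by simp
  have t123: "total_occ [1,2,3] n = (n choose 3) * 2 ^ (n - 3)"
    using total_occ_snoc[of "[1,2]" 3 n] t12 assms by (simp add: numeral_2_eq_2 numeral_3_eq_3)
  have t213: "total_occ [2,1,3] n = (n choose 3) * 2 ^ (n - 3)"
    using total_occ_snoc[of "[2,1]" 3 n] t21 assms by (simp add: numeral_2_eq_2 numeral_3_eq_3)
  show ?thesis
    using t123 t213 total_occ_rev[of "[1,2,3]" n] total_occ_rev[of "[2,1,3]" n] by simp
qed

end
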